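(* For any class $\mathtt C\subseteq[n\to 2]$, $\ \dim_{\mathrm h}\mathtt C\ \ge\ \dim_{\mathrm{VC}}\mathtt C$.
   Context: $[n]=\{0,\dots,n-1\}$ and $[n\to 2]$ is the set of all functions $[n]\to\{0,1\}$. Fix a field $\Bbbk$ and let $S=\Bbbk[x_{u,i}:u\in[n],\,i\in\{0,1\}]$. For a function $f$ let $\Gamma f=([n]\times\{0,1\})\setminus\operatorname{graph} f$, and for $\sigma\subseteq [n]\times\{0,1\}$ let $\mathbf x^\sigma=\prod_{(u,i)\in\sigma}x_{u,i}$. The canonical ideal of $\mathtt C$ is $I^\star_{\mathtt C}=\langle \mathbf x^{\Gamma f}: f\in\mathtt C\rangle\subseteq S$. The homological dimension $\dim_{\mathrm h}\mathtt C$ is the projective dimension of the $S$-module $I^\star_{\mathtt C}$, i.e. the length of its minimal free resolution. $\mathtt C$ shatters $U\subseteq[n]$ if the set of restrictions $\{f|_U:f\in\mathtt C\}$ equals the set of all functions $U\to\{0,1\}$; the VC dimension $\dim_{\mathrm{VC}}\mathtt C$ is the largest size of a set shattered by $\mathtt C$. *)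

theory Defs
  imports
    "HOL-Algebra.Module"
    "HOL-Algebra.Ideal"
    "HOL-Algebra.AbelCoset"
    "HOL-Library.Poly_Mapping"
    "HOL-Library.Extended_Real"
    "HOL-Library.FuncSet"
begin

section \<open>Projective dimension of a module over a commutative ring\<close>

definition mod_hom ::
  "('a, 'r) ring_scheme \<Rightarrow> ('a, 'b, 'm) module_scheme \<Rightarrow> ('a, 'c, 'n) module_scheme \<Rightarrow> ('b \<Rightarrow> 'c) set"
  where "mod_hom R M N =
    {h \<in> carrier M \<rightarrow> carrier N.
       (\<forall>x\<in>carrier M. \<forall>y\<in>carrier M. h (x \<oplus>\<^bsub>M\<^esub> y) = h x \<oplus>\<^bsub>N\<^esub> h y) \<and>
       (\<forall>a\<in>carrier R. \<forall>x\<in>carrier M. h (a \<odot>\<^bsub>M\<^esub> x) = a \<odot>\<^bsub>N\<^esub> h x)}"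

text \<open>
  The lifting property. A definition in HOL cannot quantify over the carrier types of the test
  modules \<open>A\<close> and \<open>B\<close>, but the types chosen here lose nothing: for \<open>B = P\<close>, \<open>h = id\<close> and \<open>A\<close> the
  free module on the carrier of \<open>P\<close> (finitely supported functions \<open>'p \<Rightarrow> 'a\<close>) it says that \<open>P\<close> is a
  direct summand of a free module, which implies the lifting property for test modules over
  arbitrary types.
\<close>
definition projective_module :: "'a ring \<Rightarrow> ('a, 'p) module \<Rightarrow> bool"
  where "projective_module R P \<longleftrightarrow>
    Module.module R P \<and>
    (\<forall>(A :: ('a, 'p \<Rightarrow> 'a) module) (B :: ('a, 'p) module) g h.
       Module.module R A \<and> Module.module R B \<and>
       g \<in> mod_hom R A B \<and> g ` carrier A = carrier B \<and> h \<in> mod_hom R P B \<longrightarrow>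
       (\<exists>k \<in> mod_hom R P A. \<forall>x\<in>carrier P. g (k x) = h x))"

text \<open>
  The exact sequence \<open>\<dots> \<rightarrow> P 2 \<rightarrow> P 1 \<rightarrow> P 0 \<rightarrow> M \<rightarrow> 0\<close> with \<open>d i : P (i + 1) \<rightarrow> P i\<close> and
  augmentation \<open>e : P 0 \<rightarrow> M\<close>.
\<close>
definition projective_resolution ::
  "'a ring \<Rightarrow> ('a, 'm) module \<Rightarrow> (nat \<Rightarrow> ('a, 'p) module) \<Rightarrow> (nat \<Rightarrow> 'p \<Rightarrow> 'p) \<Rightarrow> ('p \<Rightarrow> 'm) \<Rightarrow> bool"
  where "projective_resolution R M P d e \<longleftrightarrow>
    (\<forall>i. projective_module R (P i)) \<and>
    (\<forall>i. d i \<in> mod_hom R (P (Suc i)) (P i)) \<and>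
    e \<in> mod_hom R (P 0) M \<and>
    e ` carrier (P 0) = carrier M \<and>
    d 0 ` carrier (P 1) = a_kernel (P 0) M e \<and>
    (\<forall>i. d (Suc i) ` carrier (P (Suc (Suc i))) = a_kernel (P (Suc i)) (P i) (d i))"

text \<open>The largest degree of a nonzero term; \<open>-\<infinity>\<close> if all terms vanish.\<close>
definition resolution_length :: "(nat \<Rightarrow> ('a, 'p) module) \<Rightarrow> ereal"
  where "resolution_length P = Sup {ereal (real i) | i. carrier (P i) \<noteq> {\<zero>\<^bsub>P i\<^esub>}}"

text \<open>
  The resolutions range over modules carried by the type \<open>('a + 'm) list\<close>. Its cardinality is the
  maximum of \<open>\<aleph>\<^sub>0\<close> and the cardinalities of \<open>'a\<close> and \<open>'m\<close>, so it has room for the free module on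
  the carrier of \<open>M\<close>, for the free module on the kernel of its augmentation, and so on, as well as
  for all kernels occurring on the way. Hence it contains a resolution of the least possible
  length. The zero module has projective dimension \<open>-\<infinity>\<close>.
\<close>
definition projective_dimension :: "'a ring \<Rightarrow> ('a, 'm) module \<Rightarrow> ereal"
  where "projective_dimension R M =
    Inf {resolution_length P | (P :: nat \<Rightarrow> ('a, ('a + 'm) list) module) d e.
           projective_resolution R M P d e}"

definition ideal_module :: "'a ring \<Rightarrow> 'a set \<Rightarrow> ('a, 'a) module"
  where "ideal_module R I =
    \<lparr>carrier = I, mult = mult R, one = one R, zero = zero R, add = add R, smult = mult R\<rparr>"


section \<open>The canonical ideal of a function class\<close>

text \<open>
  The elements of \<open>[n \<rightarrow> 2]\<close> are the members of \<open>{..<n} \<rightarrow>\<^sub>E {0, 1}\<close>, functions that are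
  \<open>undefined\<close> outside \<open>{..<n}\<close>.
\<close>
abbreviation function_space :: "nat \<Rightarrow> (nat \<Rightarrow> nat) set"
  where "function_space n \<equiv> {..<n} \<rightarrow>\<^sub>E {0, 1}"

text \<open>
  A polynomial maps each exponent vector to its coefficient, and an exponent vector maps each
  variable \<open>(u, i)\<close> to its exponent; both have finite support.
\<close>
type_synonym 'k mpoly = "(nat \<times> nat \<Rightarrow>\<^sub>0 nat) \<Rightarrow>\<^sub>0 'k"

text \<open>The ring \<open>S\<close>: polynomials in which only variables from \<open>[n] \<times> {0, 1}\<close> occur.\<close>
definition poly_ring :: "nat \<Rightarrow> 'k::field mpoly ring"
  where "poly_ring n =
    \<lparr>carrier = {p. \<forall>m \<in> Poly_Mapping.keys p. Poly_Mapping.keys m \<subseteq> {..<n} \<times> {0, 1}},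
     mult = (*), one = 1, zero = 0, add = (+)\<rparr>"

definition pvar :: "nat \<times> nat \<Rightarrow> 'k::field mpoly"
  where "pvar v = Poly_Mapping.single (Poly_Mapping.single v 1) 1"

definition sqfree_monomial :: "(nat \<times> nat) set \<Rightarrow> 'k::field mpoly"
  where "sqfree_monomial \<sigma> = (\<Prod>v\<in>\<sigma>. pvar v)"

definition graph_complement :: "nat \<Rightarrow> (nat \<Rightarrow> nat) \<Rightarrow> (nat \<times> nat) set"
  where "graph_complement n f = ({..<n} \<times> {0, 1}) - {(u, f u) | u. u < n}"

definition canonical_ideal :: "nat \<Rightarrow> (nat \<Rightarrow> nat) set \<Rightarrow> 'k::field mpoly set"
  where "canonical_ideal n C =
    Idl\<^bsub>poly_ring n\<^esub> ((\<lambda>f. sqfree_monomial (graph_complement n f)) ` C)"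

definition homological_dim :: "'k::field itself \<Rightarrow> nat \<Rightarrow> (nat \<Rightarrow> nat) set \<Rightarrow> ereal"
  where "homological_dim (_ :: 'k itself) n C =
    projective_dimension (poly_ring n :: 'k mpoly ring)
      (ideal_module (poly_ring n) (canonical_ideal n C))"


section \<open>VC dimension\<close>

definition shatters :: "(nat \<Rightarrow> nat) set \<Rightarrow> nat set \<Rightarrow> bool"
  where "shatters C U \<longleftrightarrow> (\<lambda>f. restrict f U) ` C = U \<rightarrow>\<^sub>E {0, 1}"

text \<open>The empty class shatters nothing, not even \<open>{}\<close>, and has VC dimension \<open>-\<infinity>\<close>.\<close>
definition VC_dim :: "nat \<Rightarrow> (nat \<Rightarrow> nat) set \<Rightarrow> ereal"
  where "VC_dim n C = Sup {ereal (real (card U)) | U. U \<subseteq> {..<n} \<and> shatters C U}"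

end

theory Submission
  imports Defs
begin

text \<open>
  Let \<open>U\<close> be shattered by \<open>C\<close> and let \<open>P\<close> be a projective resolution of the canonical ideal \<open>I\<close>. The
  term of \<open>P\<close> in degree \<open>|U|\<close> cannot vanish (\<open>resolution_term_nonzero\<close>), which gives the inequality.

  For \<open>V \<subseteq> U\<close> let \<open>J(V)\<close> be the product of the ideals \<open>(x\<^bsub>u,0\<^esub>, x\<^bsub>u,1\<^esub>)\<close> with \<open>u \<in> V\<close>. Every generator of \<open>I\<close>
  contains one of the two variables of each coordinate, hence \<open>I \<subseteq> J(U)\<close>. For \<open>w \<in> V\<close> there is a short
  exact sequence \<open>0 \<rightarrow> J(V - {w}) \<rightarrow> J(V - {w})\<^sup>2 \<rightarrow> J(V) \<rightarrow> 0\<close> with the maps \<open>c \<mapsto> (x\<^bsub>w,1\<^esub> c, - x\<^bsub>w,0\<^esub> c)\<close> and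
  \<open>(a, b) \<mapsto> x\<^bsub>w,0\<^esub> a + x\<^bsub>w,1\<^esub> b\<close>. Removing the elements of \<open>U\<close> one by one and splicing these
  sequences, one obtains an element of \<open>Ext\<^sup>k(J(U), S)\<close> for \<open>k = |U|\<close>, and the inclusion pulls it
  back to \<open>Ext\<^sup>k(I, S)\<close>. This class is represented by a map on the term of \<open>P\<close> in degree \<open>k\<close>, built
  by lifting along the sequences (\<open>cube_stage_step\<close>).

  That the map is not zero is seen by evaluating it. Since \<open>U\<close> is shattered, \<open>I\<close> contains the
  monomials \<open>M \<Prod>\<^sub>u x\<^bsub>u,1-g(u)\<^esub>\<close> for all vertices \<open>g\<close> of the cube \<open>{0, 1}\<^sup>U\<close>, where \<open>M\<close> is the
  product of all variables outside \<open>U\<close>. These are connected by the relations of the cubical complex, in which a face is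
  mapped to the alternating sum of its facets, each multiplied by one variable. As \<open>P\<close> is exact and the
  boundary of a boundary is zero (\<open>cube_boundary_boundary\<close>), the faces of dimension \<open>i\<close> can be
  represented by elements of \<open>P\<close> in degree \<open>i\<close>. The map above sends the element for the whole cube
  to a polynomial in which \<open>M\<close> occurs with a nonzero coefficient. To see this, the
  coefficient of a single monomial is followed from the vertex \<open>1\<close> through a chain of faces, one for
  each step of the construction.
\<close>

section \<open>Division by a variable\<close>

text \<open>
  The literal \<open>1\<close> occurs as an exponent and as an index of a variable. It stays a literal, so that
  facts about \<open>single v 1\<close> and \<open>(u, 1)\<close> match after simplification.
\<close>
declare One_nat_def [simp del]

lemma lookup_pvar_mult:
  "Poly_Mapping.lookup (pvar v * p) (Poly_Mapping.single v 1 + m) = Poly_Mapping.lookup p m"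
  by (simp add: pvar_def lookup_mult lookup_single when_mult)

lemma positive_exponentE:
  fixes m :: "'a \<Rightarrow>\<^sub>0 nat"
  assumes "0 < Poly_Mapping.lookup m v"
  obtains m' where "m = Poly_Mapping.single v 1 + m'"
proof
  show "m = Poly_Mapping.single v 1 + (m - Poly_Mapping.single v 1)"
    using assms by (intro poly_mapping_eqI) (auto simp: lookup_add lookup_minus lookup_single when_def)
qed

lemma lookup_pvar_mult_eq_0:
  assumes "Poly_Mapping.lookup m v = 0"
  shows "Poly_Mapping.lookup (pvar v * p) m = 0"
proof (rule ccontr)
  assume "Poly_Mapping.lookup (pvar v * p) m \<noteq> 0"
  then have "m \<in> Poly_Mapping.keys (pvar v * p)" by (simp add: in_keys_iff)
  then obtain a where "m = Poly_Mapping.single v 1 + a"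
    using keys_mult[of "pvar v" p] by (auto simp: pvar_def)
  with assms show False by (simp add: lookup_add)
qed

text \<open>
  The quotient by a variable that discards every monomial in which the variable does not occur. It
  is additive on all polynomials, so a map followed by a division remains additive.
\<close>
definition pvar_div :: "nat \<times> nat \<Rightarrow> 'k::field mpoly \<Rightarrow> 'k mpoly"
  where "pvar_div v p = Poly_Mapping.map_key (\<lambda>m. Poly_Mapping.single v 1 + m) p"

lemma lookup_pvar_div:
  "Poly_Mapping.lookup (pvar_div v p) m = Poly_Mapping.lookup p (Poly_Mapping.single v 1 + m)"
  by (simp add: pvar_div_def map_key.rep_eq)

lemma pvar_div_add: "pvar_div v (p + q) = pvar_div v p + pvar_div v q"
  by (simp add: pvar_div_def map_key_plus)

lemma pvar_div_pvar_mult [simp]: "pvar_div v (pvar v * p) = p"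
  by (rule poly_mapping_eqI) (simp add: lookup_pvar_div lookup_pvar_mult)

lemma pvar_mult_pvar_div:
  assumes "\<And>m. m \<in> Poly_Mapping.keys p \<Longrightarrow> 0 < Poly_Mapping.lookup m v"
  shows "pvar v * pvar_div v p = p"
proof (rule poly_mapping_eqI)
  fix m
  show "Poly_Mapping.lookup (pvar v * pvar_div v p) m = Poly_Mapping.lookup p m"
  proof (cases "Poly_Mapping.lookup m v = 0")
    case True
    with assms have "m \<notin> Poly_Mapping.keys p" by force
    with True show ?thesis by (simp add: lookup_pvar_mult_eq_0 in_keys_iff)
  next
    case False
    then obtain m' where "m = Poly_Mapping.single v 1 + m'" by (auto elim: positive_exponentE)
    then show ?thesis by (simp add: lookup_pvar_mult lookup_pvar_div)
  qed
qed

section \<open>Ideals of polynomials whose monomials hit every coordinate\<close>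

definition expo :: "(nat \<times> nat) set \<Rightarrow> (nat \<times> nat \<Rightarrow>\<^sub>0 nat)"
  where "expo \<sigma> = (\<Sum>v\<in>\<sigma>. Poly_Mapping.single v 1)"

lemma lookup_expo: "finite \<sigma> \<Longrightarrow> Poly_Mapping.lookup (expo \<sigma>) v = (if v \<in> \<sigma> then 1 else 0)"
  by (simp add: expo_def lookup_sum lookup_single when_def)

lemma expo_insert:
  "finite \<sigma> \<Longrightarrow> v \<notin> \<sigma> \<Longrightarrow> expo (insert v \<sigma>) = Poly_Mapping.single v 1 + expo \<sigma>"
  by (simp add: expo_def)

lemma sqfree_monomial_eq: "finite \<sigma> \<Longrightarrow> sqfree_monomial \<sigma> = Poly_Mapping.single (expo \<sigma>) 1"
  by (induction \<sigma> rule: finite_induct)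
     (auto simp: sqfree_monomial_def expo_def pvar_def mult_single)

lemma poly_ring_simps [simp]:
  "mult (poly_ring n) = (*)" "one (poly_ring n) = 1" "zero (poly_ring n) = 0"
  "add (poly_ring n) = (+)"
  by (simp_all add: poly_ring_def)

text \<open>
  The product of the prime ideals \<open>(x\<^bsub>u,0\<^esub>, x\<^bsub>u,1\<^esub>)\<close> for \<open>u \<in> V\<close>, where \<open>V \<subseteq> [n]\<close>. Because
  these primes involve disjoint sets of variables, the product is their intersection, which is
  described monomial by monomial.
\<close>
definition hitting_ideal :: "nat \<Rightarrow> nat set \<Rightarrow> 'k::field mpoly set"
  where "hitting_ideal n V = {p \<in> carrier (poly_ring n).
    \<forall>m\<in>Poly_Mapping.keys p. \<forall>u\<in>V. 0 < Poly_Mapping.lookup m (u, 0) + Poly_Mapping.lookup m (u, 1)}"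

lemma hitting_ideal_empty: "hitting_ideal n {} = carrier (poly_ring n)"
  by (auto simp: hitting_ideal_def)

lemma hitting_ideal_I:
  assumes "\<And>m. Poly_Mapping.lookup p m \<noteq> 0 \<Longrightarrow> Poly_Mapping.keys m \<subseteq> {..<n} \<times> {0, 1}"
    and "\<And>m u. Poly_Mapping.lookup p m \<noteq> 0 \<Longrightarrow> u \<in> V \<Longrightarrow>
      0 < Poly_Mapping.lookup m (u, 0) + Poly_Mapping.lookup m (u, 1)"
  shows "p \<in> hitting_ideal n V"
  using assms by (auto simp: hitting_ideal_def poly_ring_def in_keys_iff)

lemma hitting_ideal_D:
  assumes "p \<in> hitting_ideal n V" "Poly_Mapping.lookup p m \<noteq> 0"
  shows "Poly_Mapping.keys m \<subseteq> {..<n} \<times> {0, 1}"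
    and "u \<in> V \<Longrightarrow> 0 < Poly_Mapping.lookup m (u, 0) + Poly_Mapping.lookup m (u, 1)"
  using assms by (auto simp: hitting_ideal_def poly_ring_def in_keys_iff)

lemma hitting_ideal_antimono:
  assumes "V \<subseteq> W"
  shows "hitting_ideal n W \<subseteq> hitting_ideal n V"
proof
  fix p :: "'k::field mpoly" assume "p \<in> hitting_ideal n W"
  then show "p \<in> hitting_ideal n V"
    using hitting_ideal_D[of p n W] assms by (intro hitting_ideal_I) (simp_all add: subsetD)
qed

lemma hitting_ideal_add:
  "p \<in> hitting_ideal n V \<Longrightarrow> q \<in> hitting_ideal n V \<Longrightarrow> p + q \<in> hitting_ideal n V"
  by (rule hitting_ideal_I; metis hitting_ideal_D add.right_neutral lookup_add add_cancel_left_left)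

lemma hitting_ideal_uminus: "p \<in> hitting_ideal n V \<Longrightarrow> - p \<in> hitting_ideal n V"
  by (auto simp: hitting_ideal_def poly_ring_def)

lemma hitting_ideal_mult:
  assumes "a \<in> carrier (poly_ring n)" "p \<in> hitting_ideal n V"
  shows "a * p \<in> hitting_ideal n V"
proof (rule hitting_ideal_I)
  fix m assume "Poly_Mapping.lookup (a * p) m \<noteq> 0"
  then obtain k l where m: "m = k + l" "k \<in> Poly_Mapping.keys a" "Poly_Mapping.lookup p l \<noteq> 0"
    using keys_mult[of a p] by (auto simp: in_keys_iff)
  have "Poly_Mapping.keys k \<subseteq> {..<n} \<times> {0, 1}"
    using assms(1) m(2) by (auto simp: poly_ring_def)
  then show "Poly_Mapping.keys m \<subseteq> {..<n} \<times> {0, 1}"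
    using hitting_ideal_D(1)[OF assms(2) m(3)] keys_add[of k l] unfolding m(1) by blast
  show "0 < Poly_Mapping.lookup m (u, 0) + Poly_Mapping.lookup m (u, 1)" if "u \<in> V" for u
    using hitting_ideal_D(2)[OF assms(2) m(3) that] by (auto simp: m(1) lookup_add)
qed

lemma zero_in_hitting_ideal: "0 \<in> hitting_ideal n V"
  by (simp add: hitting_ideal_def poly_ring_def)

lemma pvar_mult_hitting_ideal:
  assumes "u < n" "i \<in> {0, 1}" "p \<in> hitting_ideal n V"
  shows "pvar (u, i) * p \<in> hitting_ideal n (insert u V)"
proof (rule hitting_ideal_I)
  fix m assume "Poly_Mapping.lookup (pvar (u, i) * p) m \<noteq> 0"
  then obtain m' where m: "m = Poly_Mapping.single (u, i) 1 + m'"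
    using lookup_pvar_mult_eq_0 by (metis positive_exponentE gr0I)
  have m': "Poly_Mapping.lookup p m' \<noteq> 0"
    using \<open>Poly_Mapping.lookup (pvar (u, i) * p) m \<noteq> 0\<close> by (simp add: m lookup_pvar_mult)
  show "Poly_Mapping.keys m \<subseteq> {..<n} \<times> {0, 1}"
    using hitting_ideal_D(1)[OF assms(3) m'] assms(1,2)
      keys_add[of "Poly_Mapping.single (u, i) 1" m'] by (auto simp: m)
  fix v assume "v \<in> insert u V"
  then show "0 < Poly_Mapping.lookup m (v, 0) + Poly_Mapping.lookup m (v, 1)"
    using hitting_ideal_D(2)[OF assms(3) m', of v] assms(2)
    by (cases "v = u") (auto simp: m lookup_add lookup_single)
qed

lemma pvar_div_hitting_ideal:
  assumes "p \<in> hitting_ideal n V" "u \<notin> V"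
  shows "pvar_div (u, i) p \<in> hitting_ideal n V"
proof (rule hitting_ideal_I)
  fix m assume "Poly_Mapping.lookup (pvar_div (u, i) p) m \<noteq> 0"
  then have m: "Poly_Mapping.lookup p (Poly_Mapping.single (u, i) 1 + m) \<noteq> 0"
    by (simp add: lookup_pvar_div)
  show "Poly_Mapping.keys m \<subseteq> {..<n} \<times> {0, 1}"
    using hitting_ideal_D(1)[OF assms(1) m] by (force simp: in_keys_iff lookup_add subset_iff)
  fix v assume "v \<in> V"
  then show "0 < Poly_Mapping.lookup m (v, 0) + Poly_Mapping.lookup m (v, 1)"
    using hitting_ideal_D(2)[OF assms(1) m, of v] assms(2) by (auto simp: lookup_add lookup_single when_def split: if_splits)
qed

text \<open>
  Surjectivity in the short exact sequence \<open>0 \<rightarrow> J(V) \<rightarrow> J(V)\<^sup>2 \<rightarrow> J(V \<union> {u}) \<rightarrow> 0\<close>, where \<open>J\<close> is the hitting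
  ideal: the monomials divisible by \<open>x\<^bsub>u,0\<^esub>\<close> are collected in \<open>a\<close>, and each of the others must be
  divisible by \<open>x\<^bsub>u,1\<^esub>\<close>.
\<close>
lemma hitting_ideal_insert_decompose:
  assumes "p \<in> hitting_ideal n (insert u V)" "u \<notin> V"
  obtains a b where "a \<in> hitting_ideal n V" "b \<in> hitting_ideal n V"
    "p = pvar (u, 0) * a + pvar (u, 1) * b"
proof
  define a where "a = pvar_div (u, 0) p"
  define q where "q = p - pvar (u, 0) * a"
  have q: "Poly_Mapping.lookup q m =
      (if Poly_Mapping.lookup m (u, 0) = 0 then Poly_Mapping.lookup p m else 0)" for m
  proof (cases "Poly_Mapping.lookup m (u, 0) = 0")
    case True
    then show ?thesis by (simp add: q_def lookup_minus lookup_pvar_mult_eq_0)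
  next
    case False
    then obtain m' where "m = Poly_Mapping.single (u, 0) 1 + m'" by (auto elim: positive_exponentE)
    with False show ?thesis by (simp add: q_def a_def lookup_minus lookup_pvar_mult lookup_pvar_div)
  qed
  have qJ: "q \<in> hitting_ideal n (insert u V)"
    by (rule hitting_ideal_I) (use hitting_ideal_D[OF assms(1)] q in \<open>metis+\<close>)
  show "a \<in> hitting_ideal n V" "pvar_div (u, 1) q \<in> hitting_ideal n V"
    using assms qJ hitting_ideal_antimono[of V "insert u V" n]
    by (auto simp: a_def intro: pvar_div_hitting_ideal)
  have "pvar (u, 1) * pvar_div (u, 1) q = q"
  proof (rule pvar_mult_pvar_div)
    fix m assume "m \<in> Poly_Mapping.keys q"
    then have "Poly_Mapping.lookup q m \<noteq> 0" by (simp add: in_keys_iff)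
    then show "0 < Poly_Mapping.lookup m (u, 1)"
      using q[of m] hitting_ideal_D(2)[OF qJ, of m u] by (auto split: if_splits)
  qed
  then show "p = pvar (u, 0) * a + pvar (u, 1) * pvar_div (u, 1) q"
    by (simp add: q_def)
qed

text \<open>
  Exactness in the middle of that sequence: the relations between two variables are the Koszul
  relations, so \<open>r\<close> determines the element of \<open>J(V)\<close> that the pair \<open>(r, s)\<close> comes from.
\<close>
lemma pvar_syzygy:
  assumes "pvar v * r + pvar w * s = 0" "v \<noteq> w"
  shows "r = pvar w * pvar_div w r"
proof (rule pvar_mult_pvar_div[symmetric])
  fix m assume "m \<in> Poly_Mapping.keys r"
  then have "Poly_Mapping.lookup (pvar v * r) (Poly_Mapping.single v 1 + m) \<noteq> 0"
    by (simp add: lookup_pvar_mult in_keys_iff)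
  moreover have "pvar v * r = - (pvar w * s)"
    using assms(1) by (simp add: eq_neg_iff_add_eq_0)
  ultimately have "Poly_Mapping.lookup (pvar w * s) (Poly_Mapping.single v 1 + m) \<noteq> 0"
    by simp
  then have "Poly_Mapping.lookup (Poly_Mapping.single v 1 + m) w \<noteq> 0"
    using lookup_pvar_mult_eq_0 by blast
  then show "0 < Poly_Mapping.lookup m w"
    using assms(2) by (simp add: lookup_add lookup_single)
qed

lemma cring_poly_ring: "cring (poly_ring n :: 'k::field mpoly ring)"
proof -
  have plus: "p + q \<in> carrier (poly_ring n)"
    if "p \<in> carrier (poly_ring n)" "q \<in> carrier (poly_ring n)" for p q :: "'k mpoly"
    using that hitting_ideal_add[of p n "{}" q] by (simp add: hitting_ideal_empty)
  have times: "p * q \<in> carrier (poly_ring n)"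
    if "p \<in> carrier (poly_ring n)" "q \<in> carrier (poly_ring n)" for p q :: "'k mpoly"
    using that hitting_ideal_mult[of p n q "{}"] by (simp add: hitting_ideal_empty)
  have uminus: "- p \<in> carrier (poly_ring n)" if "p \<in> carrier (poly_ring n)" for p :: "'k mpoly"
    using that by (simp add: poly_ring_def)
  have "0 \<in> carrier (poly_ring n)" "1 \<in> carrier (poly_ring n)"
    by (simp_all add: poly_ring_def)
  with plus times uminus show ?thesis
    by (intro cringI abelian_groupI comm_monoidI)
       (auto simp: algebra_simps intro: bexI[of _ "- x" for x])
qed

lemma ideal_hitting_ideal: "ideal (hitting_ideal n V) (poly_ring n :: 'k::field mpoly ring)"
proof -
  interpret cring "poly_ring n :: 'k mpoly ring" by (rule cring_poly_ring)
  show ?thesis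
  proof (rule idealI)
    show "subgroup (hitting_ideal n V) (add_monoid (poly_ring n :: 'k mpoly ring))"
    proof (rule add.subgroupI)
      fix p :: "'k mpoly" assume "p \<in> hitting_ideal n V"
      then show "\<ominus>\<^bsub>poly_ring n\<^esub> p \<in> hitting_ideal n V"
        using hitting_ideal_uminus[of p n V] minus_equality[of "- p" p]
        by (auto simp: hitting_ideal_def poly_ring_def)
    next
      show "(hitting_ideal n V :: 'k mpoly set) \<noteq> {}"
        using zero_in_hitting_ideal by auto
    next
      show "(hitting_ideal n V :: 'k mpoly set) \<subseteq> carrier (poly_ring n)"
        by (auto simp: hitting_ideal_def)
    next
      fix p q :: "'k mpoly" assume "p \<in> hitting_ideal n V" "q \<in> hitting_ideal n V"
      then show "p \<oplus>\<^bsub>poly_ring n\<^esub> q \<in> hitting_ideal n V"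
        by (simp add: hitting_ideal_add)
    qed
    fix a x :: "'k mpoly" assume "a \<in> hitting_ideal n V" "x \<in> carrier (poly_ring n)"
    then show "x \<otimes>\<^bsub>poly_ring n\<^esub> a \<in> hitting_ideal n V" "a \<otimes>\<^bsub>poly_ring n\<^esub> x \<in> hitting_ideal n V"
      using hitting_ideal_mult[of x n a V] by (simp_all add: mult.commute)
  qed (rule ring_axioms)
qed

section \<open>Lifting module homomorphisms\<close>

lemma module_ideal_module:
  assumes "cring R" "ideal I R"
  shows "Module.module R (ideal_module R I)"
proof -
  interpret cring R by fact
  interpret ideal I R by fact
  show ?thesis
  proof (rule moduleI)
    show "abelian_group (ideal_module R I)"
    proof (rule abelian_groupI)
      fix x assume "x \<in> carrier (ideal_module R I)"
      then show "\<exists>y\<in>carrier (ideal_module R I). y \<oplus>\<^bsub>ideal_module R I\<^esub> x = \<zero>\<^bsub>ideal_module R I\<^esub>"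
        by (intro bexI[of _ "\<ominus>\<^bsub>R\<^esub> x"]) (auto simp: ideal_module_def a_Hcarr l_neg)
    qed (auto simp: ideal_module_def a_ac a_Hcarr)
  qed (auto simp: ideal_module_def I_l_closed a_Hcarr l_distr r_distr m_assoc assms(1))
qed

text \<open>
  The definition of a projective module offers only test modules over two particular types. The
  surjection \<open>J\<^sup>2 \<rightarrow> I\<close>, \<open>(a, b) \<mapsto> x a + y b\<close>, is transported there: \<open>I\<close> becomes a module of singleton
  lists, and \<open>J\<^sup>2\<close> is replaced by the module of all families in \<open>J\<close> indexed by lists, of which the
  map reads only the two entries at the indices \<open>s\<close> and \<open>t\<close>.
\<close>
lemma projective_lift_pair:
  fixes R :: "'a ring" and P :: "('a, ('a + 'm) list) module"
  assumes proj: "projective_module R P" and R: "cring R" and I: "ideal I R" and J: "ideal J R"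
    and xy: "x \<in> carrier R" "y \<in> carrier R"
    and into: "\<And>a b. a \<in> J \<Longrightarrow> b \<in> J \<Longrightarrow> x \<otimes>\<^bsub>R\<^esub> a \<oplus>\<^bsub>R\<^esub> y \<otimes>\<^bsub>R\<^esub> b \<in> I"
    and onto: "\<And>c. c \<in> I \<Longrightarrow> \<exists>a\<in>J. \<exists>b\<in>J. c = x \<otimes>\<^bsub>R\<^esub> a \<oplus>\<^bsub>R\<^esub> y \<otimes>\<^bsub>R\<^esub> b"
    and \<gamma>: "\<gamma> \<in> mod_hom R P (ideal_module R I)"
  obtains \<beta> \<beta>' where "\<beta> \<in> mod_hom R P (ideal_module R J)" "\<beta>' \<in> mod_hom R P (ideal_module R J)"
    "\<And>z. z \<in> carrier P \<Longrightarrow> \<gamma> z = x \<otimes>\<^bsub>R\<^esub> \<beta> z \<oplus>\<^bsub>R\<^esub> y \<otimes>\<^bsub>R\<^esub> \<beta>' z"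
proof -
  interpret cring R by fact
  interpret I: ideal I R by fact
  interpret J: ideal J R by fact
  define enc :: "'a \<Rightarrow> ('a + 'm) list" where "enc a = [Inl a]" for a
  define dec :: "('a + 'm) list \<Rightarrow> 'a" where "dec l = projl (hd l)" for l
  have dec [simp]: "dec (enc a) = a" for a by (simp add: enc_def dec_def)
  define A :: "('a, ('a + 'm) list \<Rightarrow> 'a) module" where
    "A = \<lparr>carrier = UNIV \<rightarrow> J, mult = undefined, one = undefined, zero = (\<lambda>_. \<zero>\<^bsub>R\<^esub>),
      add = (\<lambda>\<phi> \<psi> l. \<phi> l \<oplus>\<^bsub>R\<^esub> \<psi> l), smult = (\<lambda>r \<phi> l. r \<otimes>\<^bsub>R\<^esub> \<phi> l)\<rparr>"
  define B :: "('a, ('a + 'm) list) module" where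
    "B = \<lparr>carrier = enc ` I, mult = undefined, one = undefined, zero = enc \<zero>\<^bsub>R\<^esub>,
      add = (\<lambda>k l. enc (dec k \<oplus>\<^bsub>R\<^esub> dec l)), smult = (\<lambda>r l. enc (r \<otimes>\<^bsub>R\<^esub> dec l))\<rparr>"
  have A: "Module.module R A"
  proof (rule moduleI)
    show "abelian_group A"
    proof (rule abelian_groupI)
      fix \<phi> assume "\<phi> \<in> carrier A"
      then show "\<exists>\<psi>\<in>carrier A. \<psi> \<oplus>\<^bsub>A\<^esub> \<phi> = \<zero>\<^bsub>A\<^esub>"
        by (intro bexI[of _ "\<lambda>l. \<ominus>\<^bsub>R\<^esub> \<phi> l"]) (auto simp: A_def Pi_iff J.a_Hcarr l_neg)
    qed (auto simp: A_def Pi_iff fun_eq_iff a_ac J.a_Hcarr)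
  qed (auto simp: A_def Pi_iff fun_eq_iff J.I_l_closed J.a_Hcarr l_distr r_distr m_assoc R)
  have B: "Module.module R B"
  proof (rule moduleI)
    show "abelian_group B"
    proof (rule abelian_groupI)
      fix l assume "l \<in> carrier B"
      then show "\<exists>k\<in>carrier B. k \<oplus>\<^bsub>B\<^esub> l = \<zero>\<^bsub>B\<^esub>"
        by (intro bexI[of _ "enc (\<ominus>\<^bsub>R\<^esub> dec l)"]) (auto simp: B_def I.a_Hcarr l_neg)
    qed (auto simp: B_def a_ac I.a_Hcarr)
  qed (auto simp: B_def I.I_l_closed I.a_Hcarr l_distr r_distr m_assoc R)
  define s t :: "('a + 'm) list" where "s = []" and "t = [undefined]"
  define g where "g \<phi> = enc (x \<otimes>\<^bsub>R\<^esub> \<phi> s \<oplus>\<^bsub>R\<^esub> y \<otimes>\<^bsub>R\<^esub> \<phi> t)" for \<phi>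
  have g: "g \<in> mod_hom R A B"
    using xy into
    by (auto simp: mod_hom_def A_def B_def g_def Pi_iff J.a_Hcarr r_distr a_ac m_lcomm)
  have "g ` carrier A = carrier B"
  proof
    show "g ` carrier A \<subseteq> carrier B" using g by (auto simp: mod_hom_def)
    show "carrier B \<subseteq> g ` carrier A"
    proof
      fix l assume "l \<in> carrier B"
      then obtain c where c: "c \<in> I" "l = enc c" by (auto simp: B_def)
      with onto[OF c(1)] obtain a b where ab: "a \<in> J" "b \<in> J" "l = enc (x \<otimes>\<^bsub>R\<^esub> a \<oplus>\<^bsub>R\<^esub> y \<otimes>\<^bsub>R\<^esub> b)"
        by blast
      then show "l \<in> g ` carrier A"
        by (intro image_eqI[of _ _ "\<lambda>l. if l = s then a else b"]) (auto simp: A_def g_def s_def t_def)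
    qed
  qed
  moreover have "(\<lambda>z. enc (\<gamma> z)) \<in> mod_hom R P B"
    using \<gamma> by (auto simp: mod_hom_def B_def ideal_module_def Pi_iff)
  ultimately obtain k where k: "k \<in> mod_hom R P A" "\<forall>z\<in>carrier P. g (k z) = enc (\<gamma> z)"
    using proj A B g unfolding projective_module_def by blast
  show thesis
  proof
    show "(\<lambda>z. k z s) \<in> mod_hom R P (ideal_module R J)" "(\<lambda>z. k z t) \<in> mod_hom R P (ideal_module R J)"
      using k(1) by (auto simp: mod_hom_def A_def ideal_module_def Pi_iff)
    show "\<gamma> z = x \<otimes>\<^bsub>R\<^esub> k z s \<oplus>\<^bsub>R\<^esub> y \<otimes>\<^bsub>R\<^esub> k z t" if "z \<in> carrier P" for z
      using k(2) that by (metis dec g_def)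
  qed
qed

lemma mod_hom_zero:
  assumes "Module.module R M" "Module.module R N" "h \<in> mod_hom R M N"
  shows "h \<zero>\<^bsub>M\<^esub> = \<zero>\<^bsub>N\<^esub>"
proof -
  interpret M: Module.module R M by fact
  interpret N: Module.module R N by fact
  have "h (\<zero>\<^bsub>R\<^esub> \<odot>\<^bsub>M\<^esub> \<zero>\<^bsub>M\<^esub>) = \<zero>\<^bsub>R\<^esub> \<odot>\<^bsub>N\<^esub> h \<zero>\<^bsub>M\<^esub>" "h \<zero>\<^bsub>M\<^esub> \<in> carrier N"
    using assms(3) by (auto simp: mod_hom_def simp del: M.smult_l_null M.smult_r_null)
  then show ?thesis by simp
qed

lemma mod_hom_finsum:
  assumes "Module.module R M" "Module.module R N" "h \<in> mod_hom R M N"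
    and "finite X" "f \<in> X \<rightarrow> carrier M"
  shows "h (finsum M f X) = finsum N (\<lambda>x. h (f x)) X"
proof -
  interpret M: Module.module R M by fact
  interpret N: Module.module R N by fact
  have h: "\<And>a. a \<in> carrier M \<Longrightarrow> h a \<in> carrier N"
    "\<And>a b. a \<in> carrier M \<Longrightarrow> b \<in> carrier M \<Longrightarrow> h (a \<oplus>\<^bsub>M\<^esub> b) = h a \<oplus>\<^bsub>N\<^esub> h b"
    using assms(3) by (auto simp: mod_hom_def)
  show ?thesis
    using assms(4,5)
  proof (induction X rule: finite_induct)
    case empty
    then show ?case using mod_hom_zero[OF assms(1-3)] by simp
  next
    case (insert x X)
    then show ?case by (simp add: Pi_iff h)
  qed
qed

lemma finsum_ideal_module_poly_ring:
  assumes "ideal J (poly_ring n :: 'k::field mpoly ring)" "finite X" "\<And>x. x \<in> X \<Longrightarrow> f x \<in> J"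
  shows "finsum (ideal_module (poly_ring n) J) f X = (\<Sum>x\<in>X. f x)"
proof -
  interpret N: Module.module "poly_ring n" "ideal_module (poly_ring n) J"
    by (rule module_ideal_module[OF cring_poly_ring assms(1)])
  have simps: "carrier (ideal_module (poly_ring n) J) = J" "\<zero>\<^bsub>ideal_module (poly_ring n) J\<^esub> = 0"
    "p \<oplus>\<^bsub>ideal_module (poly_ring n) J\<^esub> q = p + q" for p q :: "'k mpoly"
    by (simp_all add: ideal_module_def)
  show ?thesis
    using assms(2,3)
    by (induction X rule: finite_induct) (auto simp: simps)
qed

text \<open>
  The vanishing on the diagonal has to be assumed separately, since \<open>x \<oplus> x = \<zero>\<close> does not force \<open>x = \<zero>\<close> when
  the group has elements of order two.
\<close>
lemma (in abelian_group) finsum_antisymmetric: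
  assumes "finite X" "\<And>a b. a \<in> X \<Longrightarrow> b \<in> X \<Longrightarrow> T a b \<in> carrier G"
    and "\<And>a. a \<in> X \<Longrightarrow> T a a = \<zero>"
    and "\<And>a b. a \<in> X \<Longrightarrow> b \<in> X \<Longrightarrow> T a b \<oplus> T b a = \<zero>"
  shows "(\<Oplus>a\<in>X. \<Oplus>b\<in>X. T a b) = \<zero>"
  using assms
proof (induction X rule: finite_induct)
  case empty
  then show ?case by simp
next
  case (insert c X)
  have T: "\<And>a b. a \<in> insert c X \<Longrightarrow> b \<in> insert c X \<Longrightarrow> T a b \<in> carrier G" by fact
  have IH: "(\<Oplus>a\<in>X. \<Oplus>b\<in>X. T a b) = \<zero>" using insert by auto
  have row: "(\<Oplus>b\<in>insert c X. T a b) = T a c \<oplus> (\<Oplus>b\<in>X. T a b)" if "a \<in> insert c X" for a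
    using insert.hyps T that by (intro finsum_insert) auto
  have "(\<Oplus>a\<in>insert c X. \<Oplus>b\<in>insert c X. T a b) =
      (\<Oplus>a\<in>insert c X. T a c \<oplus> (\<Oplus>b\<in>X. T a b))"
    by (rule finsum_cong') (use row T in auto)
  also have "\<dots> = (T c c \<oplus> (\<Oplus>b\<in>X. T c b)) \<oplus> (\<Oplus>a\<in>X. T a c \<oplus> (\<Oplus>b\<in>X. T a b))"
    using insert.hyps T by (intro finsum_insert) auto
  also have "(\<Oplus>a\<in>X. T a c \<oplus> (\<Oplus>b\<in>X. T a b)) = (\<Oplus>a\<in>X. T a c)"
    using insert.hyps T by (subst finsum_addf) (auto simp: IH)
  also have "T c c \<oplus> (\<Oplus>b\<in>X. T c b) \<oplus> (\<Oplus>a\<in>X. T a c) = (\<Oplus>b\<in>X. T c b \<oplus> T b c)"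
    using insert.hyps T insert.prems(2) by (subst finsum_addf) auto
  also have "\<dots> = \<zero>"
    by (rule add.finprod_one_eqI) (use insert.prems(3) in auto)
  finally show ?case .
qed

section \<open>The cubical boundary\<close>

text \<open>
  A face of the cube \<open>{0, 1}\<^sup>U\<close> is given by its set \<open>B\<close> of free directions and a function \<open>g\<close> that fixes the
  other coordinates. The facet where the free coordinate \<open>u\<close> is fixed to \<open>i\<close> enters the boundary
  with the variable \<open>x\<^bsub>u,i\<^esub>\<close>, the quotient of the labels of the face and of the facet, and with the usual
  sign: the position of \<open>u\<close> in \<open>B\<close>, and \<open>i\<close>.
\<close>
definition cube_coeff :: "nat set \<Rightarrow> nat \<times> nat \<Rightarrow> 'k::field mpoly"
  where "cube_coeff B v =
    (if fst v \<in> B then (- 1) ^ (card {w \<in> B. w < fst v} + snd v) * pvar v else 0)"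

text \<open>
  The elements \<open>p B g\<close> stand for the faces. The sum runs over all of \<open>U\<close>, and the
  coefficients select the directions in \<open>B\<close>; in this form the index set of a double boundary is
  a product, which makes its antisymmetry visible.
\<close>
definition cube_boundary ::
  "('k::field mpoly, 'p) module \<Rightarrow> nat set \<Rightarrow> (nat set \<Rightarrow> (nat \<Rightarrow> nat) \<Rightarrow> 'p) \<Rightarrow> nat set \<Rightarrow> (nat \<Rightarrow> nat) \<Rightarrow> 'p"
  where "cube_boundary M U p B g =
    (\<Oplus>\<^bsub>M\<^esub>v\<in>U \<times> {0, 1}. cube_coeff B v \<odot>\<^bsub>M\<^esub> p (B - {fst v}) (g(fst v := snd v)))"

lemma pvar_in_carrier: "u < n \<Longrightarrow> i \<in> {0, 1} \<Longrightarrow> pvar (u, i) \<in> carrier (poly_ring n)"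
  by (auto simp: pvar_def poly_ring_def)

lemma cube_coeff_in_carrier:
  assumes "U \<subseteq> {..<n}" "v \<in> U \<times> {0, 1}"
  shows "cube_coeff B v \<in> carrier (poly_ring n :: 'k::field mpoly ring)"
proof -
  interpret cring "poly_ring n :: 'k mpoly ring" by (rule cring_poly_ring)
  have "pvar v \<in> carrier (poly_ring n :: 'k mpoly ring)"
    using assms by (auto intro: pvar_in_carrier)
  then show ?thesis
    using hitting_ideal_uminus[of "pvar v :: 'k mpoly" n "{}"] zero_closed
    by (simp add: cube_coeff_def minus_one_power_iff hitting_ideal_empty)
qed

lemma cube_coeff_swap:
  assumes "u \<noteq> v"
  shows "cube_coeff B (u, i) * cube_coeff (B - {u}) (v, j) =
    - (cube_coeff B (v, j) * cube_coeff (B - {v}) (u, i) :: 'k::field mpoly)"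
proof (cases "u \<in> B \<and> v \<in> B")
  case True
  have *: "cube_coeff B (u, i) * cube_coeff (B - {u}) (v, j) =
    - (cube_coeff B (v, j) * cube_coeff (B - {v}) (u, i) :: 'k mpoly)"
    if "u < v" "u \<in> B" "v \<in> B" for u v i j
  proof -
    have "{w \<in> B - {v}. w < u} = {w \<in> B. w < u}" using that by auto
    moreover have "{w \<in> B. w < v} = insert u {w \<in> B - {u}. w < v}" using that by auto
    then have "card {w \<in> B. w < v} = Suc (card {w \<in> B - {u}. w < v})" by simp
    ultimately show ?thesis using that by (simp add: cube_coeff_def power_add)
  qed
  show ?thesis
  proof (cases "u < v")
    case False
    with True assms *[of v u j i] show ?thesis by simp
  qed (use True * in blast)
next
  case False
  then show ?thesis by (cases "u \<in> B") (simp_all add: cube_coeff_def)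
qed

lemma lookup_cube_coeff_mult_eq_0:
  assumes "fst v \<notin> B \<or> Poly_Mapping.lookup m v = 0"
  shows "Poly_Mapping.lookup (cube_coeff B v * p) m = 0"
  using assms
  by (auto simp: cube_coeff_def minus_one_power_iff lookup_pvar_mult_eq_0 uminus_poly_mapping.rep_eq)

lemma lookup_cube_coeff_mult:
  assumes "fst v \<in> B"
  shows "Poly_Mapping.lookup (cube_coeff B v * p) (Poly_Mapping.single v 1 + m) \<noteq> 0 \<longleftrightarrow>
    Poly_Mapping.lookup p m \<noteq> 0"
  using assms
  by (auto simp: cube_coeff_def minus_one_power_iff lookup_pvar_mult uminus_poly_mapping.rep_eq)

lemma cube_boundary_closed:
  assumes "Module.module (poly_ring n) M" "U \<subseteq> {..<n}" "\<And>B g. p B g \<in> carrier M"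
  shows "cube_boundary M U p B g \<in> carrier M"
proof -
  interpret M: Module.module "poly_ring n" M by fact
  show ?thesis
    unfolding cube_boundary_def
    by (intro M.finsum_closed Pi_I M.smult_closed cube_coeff_in_carrier[OF assms(2)] assms(3))
qed

lemma mod_hom_cube_boundary:
  fixes M :: "('k::field mpoly, 'p) module" and N :: "('k mpoly, 'q) module"
  assumes "Module.module (poly_ring n) M" "Module.module (poly_ring n) N"
    and "h \<in> mod_hom (poly_ring n) M N" "U \<subseteq> {..<n}" "\<And>B g. p B g \<in> carrier M"
  shows "h (cube_boundary M U p B g) = cube_boundary N U (\<lambda>B g. h (p B g)) B g"
proof -
  interpret M: Module.module "poly_ring n" M by fact
  interpret N: Module.module "poly_ring n" N by fact
  have fin: "finite (U \<times> {0, 1::nat})" using assms(4) finite_subset by auto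
  have hp: "h (p B g) \<in> carrier N" for B g using assms(3,5) by (auto simp: mod_hom_def)
  have "h (cube_boundary M U p B g) =
      (\<Oplus>\<^bsub>N\<^esub>v\<in>U \<times> {0, 1}. h (cube_coeff B v \<odot>\<^bsub>M\<^esub> p (B - {fst v}) (g(fst v := snd v))))"
    unfolding cube_boundary_def
    by (intro mod_hom_finsum[OF assms(1-3)] fin Pi_I M.smult_closed
        cube_coeff_in_carrier[OF assms(4)] assms(5))
  also have "\<dots> = cube_boundary N U (\<lambda>B g. h (p B g)) B g"
    unfolding cube_boundary_def
  proof (rule N.finsum_cong')
    fix v assume v: "v \<in> U \<times> {0, 1::nat}"
    have "cube_coeff B v \<in> carrier (poly_ring n :: 'k mpoly ring)"
      by (rule cube_coeff_in_carrier[OF assms(4) v])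
    then show "h (cube_coeff B v \<odot>\<^bsub>M\<^esub> p (B - {fst v}) (g(fst v := snd v))) =
        cube_coeff B v \<odot>\<^bsub>N\<^esub> h (p (B - {fst v}) (g(fst v := snd v)))"
      using assms(3,5) by (auto simp: mod_hom_def)
  qed (intro Pi_I N.smult_closed cube_coeff_in_carrier[OF assms(4)] hp | simp)+
  finally show ?thesis .
qed

text \<open>
  The two ways of fixing two free coordinates one after the other lead to the same face with
  opposite signs, so the double sum is antisymmetric.
\<close>
lemma cube_boundary_boundary:
  fixes M :: "('k::field mpoly, 'p) module"
  assumes "Module.module (poly_ring n) M" "U \<subseteq> {..<n}" "\<And>B g. p B g \<in> carrier M"
  shows "cube_boundary M U (cube_boundary M U p) B g = \<zero>\<^bsub>M\<^esub>"
proof -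
  interpret M: Module.module "poly_ring n" M by fact
  define T where "T a b = (cube_coeff B a * cube_coeff (B - {fst a}) b) \<odot>\<^bsub>M\<^esub>
      p (B - {fst a} - {fst b}) (g(fst a := snd a, fst b := snd b))" for a b
  have coeff: "cube_coeff B v \<in> carrier (poly_ring n :: 'k mpoly ring)" if "v \<in> U \<times> {0, 1}" for B v
    by (rule cube_coeff_in_carrier[OF assms(2) that])
  have mult: "a * b \<in> carrier (poly_ring n)"
    if "a \<in> carrier (poly_ring n)" "b \<in> carrier (poly_ring n)" for a b :: "'k mpoly"
    using M.R.m_closed[OF that] by simp
  have fin: "finite (U \<times> {0, 1::nat})" using assms(2) finite_subset by auto
  have T: "T a b \<in> carrier M" if "a \<in> U \<times> {0, 1}" "b \<in> U \<times> {0, 1}" for a b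
    unfolding T_def using that by (intro M.smult_closed mult coeff assms(3))
  have "cube_boundary M U (cube_boundary M U p) B g = (\<Oplus>\<^bsub>M\<^esub>a\<in>U \<times> {0, 1}. \<Oplus>\<^bsub>M\<^esub>b\<in>U \<times> {0, 1}. T a b)"
    unfolding cube_boundary_def[of M U "cube_boundary M U p"]
  proof (rule M.finsum_cong')
    fix a assume a: "a \<in> U \<times> {0, 1::nat}"
    have "cube_coeff B a \<odot>\<^bsub>M\<^esub> cube_boundary M U p (B - {fst a}) (g(fst a := snd a)) =
        (\<Oplus>\<^bsub>M\<^esub>b\<in>U \<times> {0, 1}. cube_coeff B a \<odot>\<^bsub>M\<^esub> (cube_coeff (B - {fst a}) b \<odot>\<^bsub>M\<^esub>
          p (B - {fst a} - {fst b}) (g(fst a := snd a, fst b := snd b))))"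
      unfolding cube_boundary_def
      by (intro M.finsum_smult_ldistr fin coeff[OF a] Pi_I M.smult_closed coeff assms(3))
    also have "\<dots> = (\<Oplus>\<^bsub>M\<^esub>b\<in>U \<times> {0, 1}. T a b)"
    proof (rule M.finsum_cong')
      fix b assume b: "b \<in> U \<times> {0, 1::nat}"
      show "cube_coeff B a \<odot>\<^bsub>M\<^esub> (cube_coeff (B - {fst a}) b \<odot>\<^bsub>M\<^esub>
          p (B - {fst a} - {fst b}) (g(fst a := snd a, fst b := snd b))) = T a b"
        using M.smult_assoc1[OF coeff[OF a] coeff[OF b] assms(3)] by (simp add: T_def)
    qed (use T a in auto)
    finally show "cube_coeff B a \<odot>\<^bsub>M\<^esub> cube_boundary M U p (B - {fst a}) (g(fst a := snd a)) =
        (\<Oplus>\<^bsub>M\<^esub>b\<in>U \<times> {0, 1}. T a b)" .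
  qed (use T in auto)
  also have "\<dots> = \<zero>\<^bsub>M\<^esub>"
  proof (rule M.finsum_antisymmetric)
    show "finite (U \<times> {0, 1::nat})" by (rule fin)
    have same: "T a b = \<zero>\<^bsub>M\<^esub>" if "fst a = fst b" for a b
      using that M.smult_l_null[OF assms(3)] by (simp add: T_def cube_coeff_def)
    then show "T a a = \<zero>\<^bsub>M\<^esub>" for a by simp
    fix a b assume a: "a \<in> U \<times> {0, 1::nat}" and b: "b \<in> U \<times> {0, 1::nat}"
    show "T a b \<oplus>\<^bsub>M\<^esub> T b a = \<zero>\<^bsub>M\<^esub>"
    proof (cases "fst a = fst b")
      case True
      then show ?thesis using same[of a b] same[of b a] by simp
    next
      case False
      let ?c = "cube_coeff B a * cube_coeff (B - {fst a}) b :: 'k mpoly"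
      let ?x = "p (B - {fst a} - {fst b}) (g(fst a := snd a, fst b := snd b))"
      have c: "?c \<in> carrier (poly_ring n)" by (intro mult coeff a b)
      have "cube_coeff B b * cube_coeff (B - {fst b}) a = - ?c"
        using cube_coeff_swap[of "fst b" "fst a" B "snd b" "snd a"] False by simp
      moreover have "B - {fst b} - {fst a} = B - {fst a} - {fst b}" by auto
      moreover have "g(fst b := snd b, fst a := snd a) = g(fst a := snd a, fst b := snd b)"
        using False by (rule fun_upd_twist[symmetric])
      ultimately have "T b a = (- ?c) \<odot>\<^bsub>M\<^esub> ?x" by (simp add: T_def)
      moreover have "T a b = ?c \<odot>\<^bsub>M\<^esub> ?x" by (simp add: T_def)
      moreover have "- ?c \<in> carrier (poly_ring n)"
        using c hitting_ideal_uminus[of ?c n "{}"] by (simp add: hitting_ideal_empty)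
      ultimately show ?thesis
        using M.smult_l_distr[OF c _ assms(3), of "- ?c"] M.smult_l_null[OF assms(3)] by simp
    qed
  qed (use T in auto)
  finally show ?thesis .
qed

section \<open>Dimension shifting\<close>

lemma expo_union_insert:
  "finite \<sigma> \<Longrightarrow> finite V \<Longrightarrow> (w, 0) \<notin> \<sigma> \<Longrightarrow> w \<notin> V \<Longrightarrow>
    expo (\<sigma> \<union> insert w V \<times> {0}) = Poly_Mapping.single (w, 0) 1 + expo (\<sigma> \<union> V \<times> {0})"
  by (subst expo_insert[symmetric]) (auto intro: arg_cong[where f = expo])

text \<open>
  The state after the coordinates in \<open>W\<close> have been processed, where \<open>P\<close> is the term of the resolution
  in degree \<open>|W|\<close> and \<open>d : P' \<rightarrow> P\<close>. The map \<open>\<gamma>\<close> is induced by a map from the \<open>|W|\<close>-th syzygy module of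
  the canonical ideal to \<open>J(U - W)\<close>, and the elements \<open>p B g\<close> of \<open>P\<close> form the part of a chain map
  from the cubical complex to the resolution that lives in this degree. The last condition says that
  the \<open>W\<close>-face at \<open>g = 1\<close> is not lost: its image under \<open>\<gamma>\<close> contains the monomial of the vertex \<open>1\<close>
  without the factors \<open>x\<^bsub>u,0\<^esub>\<close> for \<open>u \<in> W\<close>.
\<close>
definition cube_stage ::
  "nat \<Rightarrow> nat set \<Rightarrow> nat set \<Rightarrow> ('k::field mpoly, 'p) module \<Rightarrow> ('k mpoly, 'p) module \<Rightarrow> ('p \<Rightarrow> 'p) \<Rightarrow>
    ('p \<Rightarrow> 'k mpoly) \<Rightarrow> (nat set \<Rightarrow> (nat \<Rightarrow> nat) \<Rightarrow> 'p) \<Rightarrow> bool"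
  where "cube_stage n U W P P' d \<gamma> p \<longleftrightarrow>
    \<gamma> \<in> mod_hom (poly_ring n) P (ideal_module (poly_ring n) (hitting_ideal n (U - W))) \<and>
    (\<forall>z\<in>carrier P'. \<gamma> (d z) = 0) \<and>
    (\<forall>B g. p B g \<in> carrier P) \<and>
    (\<forall>B g. cube_boundary P U p B g \<in> d ` carrier P') \<and>
    Poly_Mapping.lookup (\<gamma> (p W (\<lambda>_. 1))) (expo (({..<n} - U) \<times> {0, 1} \<union> (U - W) \<times> {0})) \<noteq> 0"

text \<open>
  The map \<open>\<gamma>\<close> is lifted along \<open>J(V)\<^sup>2 \<rightarrow> J(V \<union> {w})\<close>, where \<open>V = U - W - {w}\<close>. On the next syzygy module \<open>\<gamma>\<close> vanishes, so the lift
  takes values in the kernel \<open>J(V)\<close>; this is the new map. The new faces are preimages of cubical boundaries.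
  The tracked monomial survives because of all the facets of the face \<open>W \<union> {w}\<close>, only the one with \<open>w\<close>
  fixed to \<open>1\<close> contributes to it: the coefficient of any other facet is a variable that does not
  divide the monomial in question.
\<close>
lemma cube_stage_step:
  fixes P :: "('k::field mpoly, ('k mpoly + 'm) list) module"
  assumes stage: "cube_stage n U W P P' d \<gamma> p"
    and U: "U \<subseteq> {..<n}" and w: "w \<in> U - W"
    and P: "projective_module (poly_ring n) P" and P': "Module.module (poly_ring n) P'"
    and d: "d \<in> mod_hom (poly_ring n) P' P"
    and d': "d' ` carrier P'' = a_kernel P' P d"
  obtains \<gamma>' p' where "cube_stage n U (insert w W) P' P'' d' \<gamma>' p'"
proof -
  let ?S = "poly_ring n :: 'k mpoly ring"
  define V where "V = U - insert w W"
  define x y :: "'k mpoly" where "x = pvar (w, 0)" and "y = pvar (w, 1)"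
  define J K :: "'k mpoly set" where "J = hitting_ideal n (U - W)" and "K = hitting_ideal n V"
  define \<sigma> where "\<sigma> = ({..<n} - U) \<times> {0, 1::nat}"
  have wn: "w < n" "w \<in> U" "w \<notin> V" "w \<notin> W" using U w by (auto simp: V_def)
  have UW: "U - W = insert w V" using w by (auto simp: V_def)
  have \<gamma>: "\<gamma> \<in> mod_hom ?S P (ideal_module ?S J)" and \<gamma>d: "\<And>z. z \<in> carrier P' \<Longrightarrow> \<gamma> (d z) = 0"
    and p: "\<And>B g. p B g \<in> carrier P"
    and bd: "\<And>B g. cube_boundary P U p B g \<in> d ` carrier P'"
    and nz: "Poly_Mapping.lookup (\<gamma> (p W (\<lambda>_. 1))) (expo (\<sigma> \<union> insert w V \<times> {0})) \<noteq> 0"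
    using stage unfolding cube_stage_def J_def \<sigma>_def UW by blast+
  have S: "cring ?S" and iJ: "ideal J ?S" and iK: "ideal K ?S"
    by (simp_all add: cring_poly_ring J_def K_def ideal_hitting_ideal)
  have P_mod: "Module.module ?S P" using P by (simp add: projective_module_def)
  interpret P: Module.module ?S P by (rule P_mod)
  interpret P': Module.module ?S P' by (rule P')
  have K_mod: "Module.module ?S (ideal_module ?S K)" by (rule module_ideal_module[OF S iK])
  have xy: "x \<in> carrier ?S" "y \<in> carrier ?S"
    using wn(1) by (auto simp: x_def y_def intro: pvar_in_carrier)
  obtain \<beta> \<beta>' where \<beta>: "\<beta> \<in> mod_hom ?S P (ideal_module ?S K)" "\<beta>' \<in> mod_hom ?S P (ideal_module ?S K)"
    and \<beta>eq: "\<And>z. z \<in> carrier P \<Longrightarrow> \<gamma> z = x * \<beta> z + y * \<beta>' z"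
  proof (rule projective_lift_pair[OF P S iJ iK xy _ _ \<gamma>])
    show "x \<otimes>\<^bsub>?S\<^esub> a \<oplus>\<^bsub>?S\<^esub> y \<otimes>\<^bsub>?S\<^esub> b \<in> J" if "a \<in> K" "b \<in> K" for a b
      using that wn(1) by (auto simp: x_def y_def J_def K_def UW intro!: hitting_ideal_add pvar_mult_hitting_ideal)
    show "\<exists>a\<in>K. \<exists>b\<in>K. c = x \<otimes>\<^bsub>?S\<^esub> a \<oplus>\<^bsub>?S\<^esub> y \<otimes>\<^bsub>?S\<^esub> b" if "c \<in> J" for c
    proof -
      from that have "c \<in> hitting_ideal n (insert w V)" by (simp add: J_def UW)
      then show ?thesis
        using wn(3) by (rule hitting_ideal_insert_decompose) (auto simp: x_def y_def K_def)
    qed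
  qed (rule that, simp_all)
  have d_closed: "\<And>z. z \<in> carrier P' \<Longrightarrow> d z \<in> carrier P"
    and d_add: "\<And>a b. a \<in> carrier P' \<Longrightarrow> b \<in> carrier P' \<Longrightarrow> d (a \<oplus>\<^bsub>P'\<^esub> b) = d a \<oplus>\<^bsub>P\<^esub> d b"
    and d_smult: "\<And>r a. r \<in> carrier ?S \<Longrightarrow> a \<in> carrier P' \<Longrightarrow> d (r \<odot>\<^bsub>P'\<^esub> a) = r \<odot>\<^bsub>P\<^esub> d a"
    using d by (auto simp: mod_hom_def)
  have \<beta>_closed: "\<And>z. z \<in> carrier P \<Longrightarrow> \<beta> z \<in> K"
    and \<beta>_add: "\<And>a b. a \<in> carrier P \<Longrightarrow> b \<in> carrier P \<Longrightarrow> \<beta> (a \<oplus>\<^bsub>P\<^esub> b) = \<beta> a + \<beta> b"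
    and \<beta>_smult: "\<And>r a. r \<in> carrier ?S \<Longrightarrow> a \<in> carrier P \<Longrightarrow> \<beta> (r \<odot>\<^bsub>P\<^esub> a) = r * \<beta> a"
    using \<beta>(1) by (auto simp: mod_hom_def ideal_module_def)
  have \<beta>_zero: "\<beta> \<zero>\<^bsub>P\<^esub> = 0"
    using mod_hom_zero[OF P_mod K_mod \<beta>(1)] by (simp add: ideal_module_def)

  define \<gamma>' where "\<gamma>' z = pvar_div (w, 1) (\<beta> (d z))" for z
  have \<gamma>': "\<beta> (d z) = y * \<gamma>' z" if "z \<in> carrier P'" for z
    unfolding \<gamma>'_def y_def
    using \<gamma>d[OF that] \<beta>eq[OF d_closed[OF that]]
    by (intro pvar_syzygy[of "(w, 0)" _ _ "\<beta>' (d z)"]) (simp_all add: x_def y_def)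
  have \<gamma>'_hom: "\<gamma>' \<in> mod_hom ?S P' (ideal_module ?S K)"
  proof -
    have "\<gamma>' (r \<odot>\<^bsub>P'\<^esub> z) = r * \<gamma>' z" if "r \<in> carrier ?S" "z \<in> carrier P'" for r z
    proof -
      have "\<gamma>' (r \<odot>\<^bsub>P'\<^esub> z) = pvar_div (w, 1) (y * (r * \<gamma>' z))"
        using that by (simp add: \<gamma>'_def[of "r \<odot>\<^bsub>P'\<^esub> z"] d_smult \<beta>_smult d_closed \<gamma>' mult_ac)
      then show ?thesis by (simp add: y_def)
    qed
    moreover have "\<gamma>' z \<in> K" if "z \<in> carrier P'" for z
      using \<beta>_closed[OF d_closed[OF that]] wn(3) unfolding \<gamma>'_def K_def
      by (rule pvar_div_hitting_ideal)
    ultimately show ?thesis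
      by (auto simp: mod_hom_def ideal_module_def \<gamma>'_def d_add \<beta>_add d_closed pvar_div_add)
  qed
  have \<gamma>'d': "\<gamma>' (d' z) = 0" if "z \<in> carrier P''" for z
  proof -
    have "d (d' z) = \<zero>\<^bsub>P\<^esub>"
      using d' that by (auto simp: a_kernel_def')
    then show ?thesis by (simp add: \<gamma>'_def \<beta>_zero pvar_div_def)
  qed

  obtain p' where p': "\<And>B g. p' B g \<in> carrier P'" "\<And>B g. d (p' B g) = cube_boundary P U p B g"
    using bd unfolding image_iff by metis
  have bd': "cube_boundary P' U p' B g \<in> d' ` carrier P''" for B g
  proof -
    have "d (cube_boundary P' U p' B g) = cube_boundary P U (cube_boundary P U p) B g"
      using mod_hom_cube_boundary[OF P' P_mod d U, of p'] p' by simp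
    also have "\<dots> = \<zero>\<^bsub>P\<^esub>"
      by (rule cube_boundary_boundary[OF P_mod U p])
    finally show ?thesis
      using cube_boundary_closed[OF P' U, of p'] p'(1) by (simp add: d' a_kernel_def')
  qed

  \<comment> \<open>Tracking the coefficient. The factor \<open>x\<close> in \<open>\<gamma> = x \<beta> + y \<beta>'\<close> first passes it to \<open>\<beta>\<close>.\<close>
  define B g m where "B = insert w W" and "g = (\<lambda>_::nat. 1::nat)" and "m = expo (\<sigma> \<union> V \<times> {0})"
  have fin: "finite \<sigma>" "finite V" "finite U"
    using U by (auto simp: \<sigma>_def V_def finite_subset)
  have m0: "Poly_Mapping.lookup m v = 0" if "fst v \<in> B" "fst v \<in> U" for v
    using that fin by (auto simp: m_def lookup_expo \<sigma>_def V_def B_def)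
  have mW: "expo (\<sigma> \<union> insert w V \<times> {0}) = Poly_Mapping.single (w, 0) 1 + m"
    unfolding m_def by (rule expo_union_insert) (use fin wn in \<open>auto simp: \<sigma>_def\<close>)
  have "Poly_Mapping.lookup (x * \<beta> (p W g) + y * \<beta>' (p W g)) (Poly_Mapping.single (w, 0) 1 + m) \<noteq> 0"
    using nz unfolding mW g_def[symmetric] \<beta>eq[OF p] .
  moreover have "Poly_Mapping.lookup (y * \<beta>' (p W g)) (Poly_Mapping.single (w, 0) 1 + m) = 0"
    unfolding y_def
    by (rule lookup_pvar_mult_eq_0) (use m0[of "(w, 1)"] wn in \<open>simp add: lookup_add lookup_single B_def\<close>)
  ultimately have \<beta>_nz: "Poly_Mapping.lookup (\<beta> (p W g)) m \<noteq> 0"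
    by (simp add: lookup_add x_def lookup_pvar_mult)

  define F where "F v = cube_coeff B v * \<beta> (p (B - {fst v}) (g(fst v := snd v)))" for v
  \<comment> \<open>The division by \<open>y\<close> is undone: the coefficient of \<open>\<gamma>'\<close> at \<open>m\<close> is that of \<open>\<beta> \<circ> d\<close> at \<open>y m\<close>.\<close>
  have F_closed: "F v \<in> K" if "v \<in> U \<times> {0, 1}" for v
    unfolding F_def K_def
    by (rule hitting_ideal_mult[OF cube_coeff_in_carrier[OF U that]])
       (use \<beta>_closed[OF p] in \<open>simp add: K_def\<close>)
  have "y * \<gamma>' (p' B g) = \<beta> (cube_boundary P U p B g)"
    using \<gamma>'[OF p'(1)] p'(2) by simp
  also have "\<dots> = cube_boundary (ideal_module ?S K) U (\<lambda>B g. \<beta> (p B g)) B g"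
    by (rule mod_hom_cube_boundary[OF P_mod K_mod \<beta>(1) U p])
  also have "\<dots> = finsum (ideal_module ?S K) F (U \<times> {0, 1})"
    by (simp add: cube_boundary_def F_def[abs_def] ideal_module_def)
  also have "\<dots> = (\<Sum>v\<in>U \<times> {0, 1}. F v)"
    using fin by (intro finsum_ideal_module_poly_ring[OF iK] F_closed) simp_all
  finally have sum: "y * \<gamma>' (p' B g) = (\<Sum>v\<in>U \<times> {0, 1}. F v)" .
  let ?m = "Poly_Mapping.single (w, 1) 1 + m"
  have "Poly_Mapping.lookup (\<gamma>' (p' B g)) m = Poly_Mapping.lookup (y * \<gamma>' (p' B g)) ?m"
    by (simp add: y_def lookup_pvar_mult)
  also have "\<dots> = (\<Sum>v\<in>U \<times> {0, 1}. Poly_Mapping.lookup (F v) ?m)"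
    by (simp add: sum lookup_sum)
  also have "\<dots> = (\<Sum>v\<in>{(w, 1)}. Poly_Mapping.lookup (F v) ?m)"
  proof (rule sum.mono_neutral_right)
    show "\<forall>v\<in>U \<times> {0, 1} - {(w, 1)}. Poly_Mapping.lookup (F v) ?m = 0"
    proof
      fix v assume v: "v \<in> U \<times> {0, 1} - {(w, 1::nat)}"
      then have "fst v \<in> U" "v \<noteq> (w, 1)" by auto
      then show "Poly_Mapping.lookup (F v) ?m = 0"
        unfolding F_def using m0[of v]
        by (intro lookup_cube_coeff_mult_eq_0) (auto simp: lookup_add lookup_single)
    qed
  qed (use fin wn in auto)
  also have "\<dots> = Poly_Mapping.lookup (F (w, 1)) ?m" by simp
  finally have "Poly_Mapping.lookup (\<gamma>' (p' B g)) m \<noteq> 0"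
    using \<beta>_nz wn(4) by (simp add: F_def lookup_cube_coeff_mult B_def g_def fun_upd_idem)
  with \<gamma>'_hom \<gamma>'d' p'(1) bd' have "cube_stage n U (insert w W) P' P'' d' \<gamma>' p'"
    unfolding cube_stage_def B_def g_def m_def \<sigma>_def K_def V_def by blast
  then show thesis by (rule that)
qed

section \<open>The canonical ideal of a shattering class\<close>

text \<open>
  The complement of the graph of \<open>g\<close> in the coordinates \<open>U\<close>, together with all variables outside
  \<open>U\<close>. The extra variables give every vertex of the cube \<open>{0, 1}\<^sup>U\<close> the same factor outside \<open>U\<close>,
  whichever function of the class restricts to it. As \<open>1 - g u\<close> is a truncated subtraction, every
  \<open>g\<close> counts as a \<open>0\<close>-\<open>1\<close> function, with nonzero values read as \<open>1\<close>.
\<close>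
definition cube_vertex :: "nat \<Rightarrow> nat set \<Rightarrow> (nat \<Rightarrow> nat) \<Rightarrow> (nat \<times> nat) set"
  where "cube_vertex n U g = ({..<n} - U) \<times> {0, 1} \<union> (\<lambda>u. (u, 1 - g u)) ` U"

lemma finite_cube_vertex: "U \<subseteq> {..<n} \<Longrightarrow> finite (cube_vertex n U g)"
  by (auto simp: cube_vertex_def intro: finite_subset)

lemma sqfree_monomial_insert:
  "finite \<sigma> \<Longrightarrow> v \<notin> \<sigma> \<Longrightarrow> sqfree_monomial (insert v \<sigma>) = pvar v * sqfree_monomial \<sigma>"
  by (simp add: sqfree_monomial_def)

lemma sqfree_monomial_in_hitting_ideal:
  assumes "\<sigma> \<subseteq> {..<n} \<times> {0, 1}" "\<And>u. u \<in> V \<Longrightarrow> (u, 0) \<in> \<sigma> \<or> (u, 1) \<in> \<sigma>"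
  shows "sqfree_monomial \<sigma> \<in> hitting_ideal n V"
proof (rule hitting_ideal_I)
  have fin: "finite \<sigma>" using assms(1) by (rule finite_subset) simp
  fix m assume "Poly_Mapping.lookup (sqfree_monomial \<sigma> :: 'k::field mpoly) m \<noteq> 0"
  then have m: "m = expo \<sigma>"
    by (auto simp: sqfree_monomial_eq[OF fin] lookup_single when_def split: if_splits)
  show "Poly_Mapping.keys m \<subseteq> {..<n} \<times> {0, 1}"
    using assms(1) by (force simp: m in_keys_iff lookup_expo[OF fin] split: if_splits)
  show "0 < Poly_Mapping.lookup m (u, 0) + Poly_Mapping.lookup m (u, 1)" if "u \<in> V" for u
    using assms(2)[OF that] by (auto simp: m lookup_expo[OF fin])
qed

lemma canonical_ideal_generators_subset:
  "(\<lambda>f. sqfree_monomial (graph_complement n f)) ` C \<subseteq> carrier (poly_ring n :: 'k::field mpoly ring)"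
proof (rule image_subsetI)
  fix f
  have "sqfree_monomial (graph_complement n f) \<in> (hitting_ideal n {} :: 'k mpoly set)"
    by (rule sqfree_monomial_in_hitting_ideal) (auto simp: graph_complement_def)
  then show "sqfree_monomial (graph_complement n f) \<in> carrier (poly_ring n :: 'k mpoly ring)"
    by (simp add: hitting_ideal_empty)
qed

lemma ideal_canonical_ideal: "ideal (canonical_ideal n C) (poly_ring n :: 'k::field mpoly ring)"
proof -
  interpret cring "poly_ring n :: 'k mpoly ring" by (rule cring_poly_ring)
  show ?thesis
    unfolding canonical_ideal_def
    by (rule genideal_ideal[OF canonical_ideal_generators_subset])
qed

lemma canonical_ideal_subset_hitting_ideal:
  assumes "C \<subseteq> function_space n" "U \<subseteq> {..<n}"
  shows "(canonical_ideal n C :: 'k::field mpoly set) \<subseteq> hitting_ideal n U"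
proof -
  interpret cring "poly_ring n :: 'k mpoly ring" by (rule cring_poly_ring)
  show ?thesis
    unfolding canonical_ideal_def
  proof (rule genideal_minimal[OF ideal_hitting_ideal], rule image_subsetI)
    fix f assume "f \<in> C"
    then have "f u \<in> {0, 1}" if "u < n" for u using assms(1) that by (auto simp: PiE_iff)
    then show "sqfree_monomial (graph_complement n f) \<in> (hitting_ideal n U :: 'k mpoly set)"
      using assms(2)
      by (intro sqfree_monomial_in_hitting_ideal) (auto simp: graph_complement_def subset_iff)
  qed
qed

lemma cube_vertex_in_canonical_ideal:
  assumes C: "C \<subseteq> function_space n" and U: "U \<subseteq> {..<n}" and sh: "shatters C U"
  shows "(sqfree_monomial (cube_vertex n U g) :: 'k::field mpoly) \<in> canonical_ideal n C"
proof -
  interpret cring "poly_ring n :: 'k mpoly ring" by (rule cring_poly_ring)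
  interpret ideal "canonical_ideal n C" "poly_ring n :: 'k mpoly ring" by (rule ideal_canonical_ideal)
  have "restrict (\<lambda>u. if g u = 0 then 0 else 1) U \<in> U \<rightarrow>\<^sub>E {0, 1::nat}" by auto
  then obtain f where f: "f \<in> C" "restrict f U = restrict (\<lambda>u. if g u = 0 then 0 else 1) U"
    using sh unfolding shatters_def by (metis (no_types, lifting) imageE)
  have fU: "f u = (if g u = 0 then 0 else 1)" if "u \<in> U" for u
    using fun_cong[OF f(2), of u] that by simp
  let ?\<sigma> = "cube_vertex n U g" and ?\<tau> = "graph_complement n f"
  have sub: "?\<tau> \<subseteq> ?\<sigma>"
    using U fU by (force simp: graph_complement_def cube_vertex_def split: if_splits)
  have "sqfree_monomial (?\<sigma> - ?\<tau>) \<in> (hitting_ideal n {} :: 'k mpoly set)"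
    using U by (intro sqfree_monomial_in_hitting_ideal) (auto simp: cube_vertex_def)
  then have "sqfree_monomial (?\<sigma> - ?\<tau>) \<in> carrier (poly_ring n :: 'k mpoly ring)"
    by (simp add: hitting_ideal_empty)
  moreover have "sqfree_monomial ?\<tau> \<in> (canonical_ideal n C :: 'k mpoly set)"
    using genideal_self[OF canonical_ideal_generators_subset] f(1) by (auto simp: canonical_ideal_def)
  ultimately have "sqfree_monomial (?\<sigma> - ?\<tau>) * sqfree_monomial ?\<tau> \<in> (canonical_ideal n C :: 'k mpoly set)"
    using I_l_closed by fastforce
  then show ?thesis
    unfolding sqfree_monomial_def
    by (subst prod.subset_diff[OF sub finite_cube_vertex[OF U]])
qed

lemma pvar_mult_cube_vertex:
  assumes "U \<subseteq> {..<n}" "u \<in> U"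
  shows "pvar (u, 0) * sqfree_monomial (cube_vertex n U (g(u := 0))) =
    (pvar (u, 1) * sqfree_monomial (cube_vertex n U (g(u := 1))) :: 'k::field mpoly)"
proof -
  have "pvar (u, i) * sqfree_monomial (cube_vertex n U (g(u := i))) =
      (sqfree_monomial (insert (u, i) (cube_vertex n U (g(u := i)))) :: 'k mpoly)"
    if "i \<in> {0, 1}" for i
  proof -
    have "(u, i) \<notin> cube_vertex n U (g(u := i))" using that assms by (auto simp: cube_vertex_def)
    then show ?thesis by (simp add: sqfree_monomial_insert finite_cube_vertex assms(1))
  qed
  moreover have "insert (u, 0) (cube_vertex n U (g(u := 0))) = insert (u, 1) (cube_vertex n U (g(u := 1)))"
    using assms by (auto simp: cube_vertex_def image_iff split: if_splits)
  ultimately show ?thesis by simp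
qed

text \<open>
  In degree zero the map is the augmentation followed by the inclusion of the canonical ideal
  in \<open>J(U)\<close>, and \<open>p B g\<close> is a preimage of the monomial at the vertex \<open>g\<close> for every \<open>B\<close>.
\<close>
lemma cube_stage_initial:
  fixes P :: "('k::field mpoly, 'p) module"
  assumes C: "C \<subseteq> function_space n" and U: "U \<subseteq> {..<n}" and sh: "shatters C U"
    and P: "Module.module (poly_ring n) P"
    and e: "e \<in> mod_hom (poly_ring n) P (ideal_module (poly_ring n) (canonical_ideal n C))"
    and onto: "e ` carrier P = canonical_ideal n C"
    and d: "d ` carrier P' = a_kernel P (ideal_module (poly_ring n) (canonical_ideal n C)) e"
  obtains p where "cube_stage n U {} P P' d e p"
proof -
  let ?S = "poly_ring n :: 'k mpoly ring"
  let ?I = "canonical_ideal n C :: 'k mpoly set"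
  define q where "q g = (sqfree_monomial (cube_vertex n U g) :: 'k mpoly)" for g
  have I: "Module.module ?S (ideal_module ?S ?I)"
    by (rule module_ideal_module[OF cring_poly_ring ideal_canonical_ideal])
  have fin: "finite U" using U finite_subset by blast
  have q: "q g \<in> ?I" for g
    unfolding q_def by (rule cube_vertex_in_canonical_ideal[OF C U sh])
  then have "\<exists>z\<in>carrier P. e z = q g" for g
    using onto by (metis imageE)
  then obtain v where v: "\<And>g. v g \<in> carrier P" "\<And>g. e (v g) = q g" by metis
  define p where "p B g = v g" for B :: "nat set" and g
  have "e (cube_boundary P U p B g) = 0" for B g
  proof -
    have "e (cube_boundary P U p B g) = cube_boundary (ideal_module ?S ?I) U (\<lambda>B. q) B g"
      using mod_hom_cube_boundary[OF P I e U, of p B g] v by (simp add: p_def)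
    also have "\<dots> = (\<Sum>x\<in>U \<times> {0, 1}. cube_coeff B x * q (g(fst x := snd x)))"
      unfolding cube_boundary_def
      using ideal.I_l_closed[OF ideal_canonical_ideal q cube_coeff_in_carrier[OF U]] fin
      by (subst finsum_ideal_module_poly_ring[OF ideal_canonical_ideal]) (auto simp: ideal_module_def)
    also have "\<dots> = (\<Sum>u\<in>U. \<Sum>i\<in>{0, 1}. cube_coeff B (u, i) * q (g(u := i)))"
      unfolding sum.cartesian_product by (simp only: split_def fst_conv snd_conv prod.collapse)
    also have "\<dots> = 0"
    proof (rule sum.neutral, rule ballI)
      fix u assume "u \<in> U"
      from pvar_mult_cube_vertex[OF U this, of g]
      have "pvar (u, 0) * q (g(u := 0)) = pvar (u, 1) * q (g(u := 1))"
        by (simp add: q_def)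
      then show "(\<Sum>i\<in>{0, 1}. cube_coeff B (u, i) * q (g(u := i))) = 0"
        by (simp add: cube_coeff_def mult.assoc power_add)
    qed
    finally show ?thesis .
  qed
  then have bd: "cube_boundary P U p B g \<in> d ` carrier P'" for B g
    using cube_boundary_closed[OF P U, of p] v(1)
    by (simp add: d a_kernel_def' p_def ideal_module_def)
  have "e (d z) = 0" if "z \<in> carrier P'" for z
    using that d by (auto simp: a_kernel_def' ideal_module_def)
  moreover have "e \<in> mod_hom ?S P (ideal_module ?S (hitting_ideal n (U - {})))"
    using e canonical_ideal_subset_hitting_ideal[OF C U]
    by (auto simp: mod_hom_def ideal_module_def)
  moreover have "cube_vertex n U (\<lambda>_. 1) = ({..<n} - U) \<times> {0, 1} \<union> (U - {}) \<times> {0}"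
    by (auto simp: cube_vertex_def)
  then have "Poly_Mapping.lookup (e (p {} (\<lambda>_. 1))) (expo (({..<n} - U) \<times> {0, 1} \<union> (U - {}) \<times> {0})) \<noteq> 0"
    using v(2) finite_cube_vertex[OF U] by (simp add: p_def q_def sqfree_monomial_eq lookup_single)
  ultimately have "cube_stage n U {} P P' d e p"
    unfolding cube_stage_def using bd v(1) by (simp add: p_def)
  then show thesis by (rule that)
qed

text \<open>
  If the term in degree \<open>|U|\<close> were zero, then the stage at \<open>W = U\<close> would provide a nonzero coefficient
  of \<open>\<gamma> 0 = 0\<close>.
\<close>
lemma resolution_term_nonzero:
  fixes P :: "nat \<Rightarrow> ('k::field mpoly, ('k mpoly + 'k mpoly) list) module"
  assumes C: "C \<subseteq> function_space n" and U: "U \<subseteq> {..<n}" and sh: "shatters C U"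
    and res: "projective_resolution (poly_ring n)
      (ideal_module (poly_ring n) (canonical_ideal n C)) P d e"
  shows "carrier (P (card U)) \<noteq> {\<zero>\<^bsub>P (card U)\<^esub>}"
proof
  let ?S = "poly_ring n :: 'k mpoly ring"
  assume zero: "carrier (P (card U)) = {\<zero>\<^bsub>P (card U)\<^esub>}"
  have carrier_ideal_module: "carrier (ideal_module ?S (canonical_ideal n C)) = canonical_ideal n C"
    by (simp add: ideal_module_def)
  have P: "\<And>i. projective_module ?S (P i)" and d: "\<And>i. d i \<in> mod_hom ?S (P (Suc i)) (P i)"
    and exact: "\<And>i. d (Suc i) ` carrier (P (Suc (Suc i))) = a_kernel (P (Suc i)) (P i) (d i)"
    and aug: "e \<in> mod_hom ?S (P 0) (ideal_module ?S (canonical_ideal n C))"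
      "e ` carrier (P 0) = canonical_ideal n C"
      "d 0 ` carrier (P 1) = a_kernel (P 0) (ideal_module ?S (canonical_ideal n C)) e"
    using res unfolding projective_resolution_def carrier_ideal_module
    by - (elim conjE; (assumption | erule spec))+
  have M: "Module.module ?S (P i)" for i
    using P by (simp add: projective_module_def)
  have stages: "\<exists>\<gamma> p. cube_stage n U W (P (card W)) (P (Suc (card W))) (d (card W)) \<gamma> p"
    if "finite W" "W \<subseteq> U" for W
    using that
  proof (induction W rule: finite_induct)
    case empty
    obtain p where "cube_stage n U {} (P 0) (P 1) (d 0) e p"
      by (rule cube_stage_initial[OF C U sh M aug])
    then show ?case by (auto simp: One_nat_def)
  next
    case (insert w W)
    then obtain \<gamma> p where "cube_stage n U W (P (card W)) (P (Suc (card W))) (d (card W)) \<gamma> p"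
      by auto
    then obtain \<gamma>' p' where "cube_stage n U (insert w W) (P (Suc (card W))) (P (Suc (Suc (card W))))
        (d (Suc (card W))) \<gamma>' p'"
      by (rule cube_stage_step[OF _ U _ P M d exact]) (use insert in auto)
    then show ?case using insert.hyps by auto
  qed
  have "finite U" using U by (rule finite_subset) simp
  from stages[OF this subset_refl] obtain \<gamma> p
    where stage: "cube_stage n U U (P (card U)) (P (Suc (card U))) (d (card U)) \<gamma> p"
    by (elim exE)
  then have "p U (\<lambda>_. 1) = \<zero>\<^bsub>P (card U)\<^esub>"
    using zero by (auto simp: cube_stage_def)
  moreover have "\<gamma> \<zero>\<^bsub>P (card U)\<^esub> = 0"
  proof -
    let ?K = "ideal_module ?S (hitting_ideal n (U - U))"
    have "Module.module ?S ?K"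
      by (rule module_ideal_module[OF cring_poly_ring ideal_hitting_ideal])
    moreover have "\<gamma> \<in> mod_hom ?S (P (card U)) ?K"
      using stage by (simp add: cube_stage_def)
    ultimately have "\<gamma> \<zero>\<^bsub>P (card U)\<^esub> = \<zero>\<^bsub>?K\<^esub>"
      by (rule mod_hom_zero[OF M])
    then show ?thesis by (simp add: ideal_module_def)
  qed
  ultimately show False
    using stage by (simp add: cube_stage_def)
qed

theorem theorem3p11:
  fixes n :: nat and C :: "(nat \<Rightarrow> nat) set"
  assumes "C \<subseteq> function_space n"
  shows "homological_dim TYPE('k::field) n C \<ge> VC_dim n C"
  unfolding VC_dim_def homological_dim_def projective_dimension_def
proof (intro Sup_least Inf_greatest; clarify)
  fix U and P :: "nat \<Rightarrow> ('k mpoly, ('k mpoly + 'k mpoly) list) module" and d e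
  assume "U \<subseteq> {..<n}" "shatters C U"
    "projective_resolution (poly_ring n) (ideal_module (poly_ring n) (canonical_ideal n C)) P d e"
  from resolution_term_nonzero[OF assms this]
  show "ereal (real (card U)) \<le> resolution_length P"
    unfolding resolution_length_def by (intro Sup_upper) auto
qed

end
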